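(* The electrical wire shift $W^{\mathrm{el}}$ is an extendible, block strongly irreducible $\mathbb{Z}^3$ shift of finite type such that $h_{\mathrm{top}}(W^{\mathrm{el}})=h_L(W^{\mathrm{el}})$ for the sublattice $L:=\langle\vec{e}_1,\vec{e}_2\rangle_{\mathbb{Z}}\subsetneq\mathbb{Z}^3$. Nevertheless $W^{\mathrm{el}}\subsetneq (W^{\mathrm{el}}_L)^{\mathbb{Z}}$.
   Context: **General notions.** For a finite alphabet $\mathcal{A}$ let $\mathcal{A}^{\mathbb{Z}^d}$ carry the product topology and the shift action $(\sigma_{\vec\imath}(x))_{\vec\jmath}=x_{\vec\imath+\vec\jmath}$. A $\mathbb{Z}^d$ shift is a closed $\sigma$-invariant subset $X\subseteq\mathcal{A}^{\mathbb{Z}^d}$. It is a shift of finite type (SFT) if $X=\{x\in\mathcal{A}^{\mathbb{Z}^d}\mid\forall\,\vec\imath\in\mathbb{Z}^d:\ x|_{\vec\imath+F}\in\mathcal{P}\}$ for some finite non-empty $F\subsetneq\mathbb{Z}^d$ and some $\mathcal{P}\subseteq\mathcal{A}^F$. For finite $F\subsetneq\mathbb{Z}^d$ put $\mathcal{L}_F(X)=\{x|_F\mid x\in X\}$. A pattern on a set $B$ is identified with its translates. Topological entropy: $h_{\mathrm{top}}(X)=\lim_{n\to\infty}\frac{\log|\mathcal{L}_{C_n}(X)|}{|C_n|}$ with $C_n=\{\vec\imath\in\mathbb{Z}^d\mid\|\vec\imath\|_\infty\le n\}$. A block is a set $[\vec u,\vec v]=\{\vec\imath\in\mathbb{Z}^d\mid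 \vec u_k\le\vec\imath_k\le\vec v_k\ \forall\,1\le k\le d\}$; $\vec{\mathbb 1}$ denotes the vector with all components equal to $1$. An SFT $X$ (given by local rules) is extendible if for any block $B$ every pattern on $B$ that violates no local rule inside $B$ lies in $\mathcal{L}_B(X)$, i.e. extends to a point of $X$. A $\mathbb{Z}^d$ shift $X$ is block strongly irreducible if there is $s\in\mathbb{N}$ such that whenever $\vec\imath,\vec\jmath\in\mathbb{Z}^d$ and $m,n\in\mathbb{N}$ are such that the distance (in the maximum metric) between $\vec\imath+[-m\vec{\mathbb 1},m\vec{\mathbb 1}]$ and $\vec\jmath+[-n\vec{\mathbb 1},n\vec{\mathbb 1}]$ is larger than $s$, then for any $P_1\in\mathcal{L}_{[-m\vec{\mathbb 1},m\vec{\mathbb 1}]}(X)$ and $P_2\in\mathcal{L}_{[-n\vec{\mathbb 1},n\vec{\mathbb 1}]}(X)$ there exists $x\in X$ with $x|_{\vec\imath+[-m\vec{\mathbb 1},m\vec{\mathbb 1}]}=P_1$ and $x|_{\vec\jmath+[-n\vec{\mathbb 1},n\vec{\mathbb 1}]}=P_2$. For $L=\langle\vec e_1,\vec e_2\rangle_{\mathbb{Z}}\cong\mathbb{Z}^2$ and a $\mathbb{Z}^3$ shift $X$: $X_L=\{x|_L\mid x\in X\}$, regarded as a $\mathbb{Z}^2$ shift; the $L$-projectional entropy is $h_L(X)=h_{\mathrm{top}}(X_L)$ (entropy as a $\mathbb{Z}^2$ shift); and $(X_L)^{\mathbb{Z}}$ is the $\mathbb{Z}^3$ shift of all $x$ such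 that for every $n\in\mathbb{Z}$ the layer $(x_{\vec u+n\vec e_3})_{\vec u\in L}$ belongs to $X_L$. **The modified wire shift $\widetilde W_2$.** The alphabet is $\mathcal{A}_2=\{1_1,1_2,2,3,4,5,6,7\}$. Each symbol is a unit square tile which carries a wire at some of its edges: $1_1,1_2$ (blanks): no edge; $2$: left, right; $3$: left, right, top; $4$: left, right, bottom; $5$: top, bottom; $6$: top, bottom, right; $7$: top, bottom, left. $\widetilde W_2$ is the $\mathbb{Z}^2$ SFT of all $w\in\mathcal{A}_2^{\mathbb{Z}^2}$ such that for every $\vec\imath\in\mathbb{Z}^2$: the tile $w_{\vec\imath}$ has a wire at its right edge if and only if $w_{\vec\imath+\vec e_1}$ has a wire at its left edge, and $w_{\vec\imath}$ has a wire at its top edge if and only if $w_{\vec\imath+\vec e_2}$ has a wire at its bottom edge. **The electrical wire shift $W^{\mathrm{el}}$.** It is the $\mathbb{Z}^3$ SFT of all $w\in\mathcal{A}_2^{\mathbb{Z}^3}$ such that (i) for every $n\in\mathbb{Z}$ the horizontal layer $(w_{\vec u+n\vec e_3})_{\vec u\in L}$ is a point of $\widetilde W_2$; and (ii) for every $\vec\imath\in\mathbb{Z}^3$: if $w_{\vec\imath}=2$ then $w_{\vec\imath\pm\vec e_3}\in\{1_1,1_2,5\}$; if $w_{\vec\imath}=5$ then $w_{\vec\imath\pm\vec e_3}\in\{1_1,1_2,2\}$; if $w_{\vec\imath}\in\{3,4,6,7\}$ then $w_{\vec\imath\pm\vec e_3}\in\{1_1,1_2\}$. These nearest-neighbor rules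 are the local rules with respect to which extendibility is understood. *)

theory Defs
  imports "HOL-Analysis.Analysis"
begin

text \<open>
  Points of \<open>\<int>\<^sup>d\<close> are vectors of type \<open>int ^ 'd\<close>, a configuration is a function
  \<open>int ^ 'd \<Rightarrow> 'a\<close> over a finite alphabet type \<open>'a\<close>, and a pattern on \<open>F\<close> is an extensional
  function in \<open>F \<rightarrow>\<^sub>E UNIV\<close>. A pattern occurring on \<open>i + F\<close> is identified with its translate
  to \<open>F\<close>, so \<open>x|\<^bsub>i+F\<^esub>\<close> is rendered as \<open>restrict (shift i x) F\<close>.
\<close>

definition shift :: "int ^ 'd \<Rightarrow> (int ^ 'd \<Rightarrow> 'a) \<Rightarrow> int ^ 'd \<Rightarrow> 'a" where
  "shift i x = (\<lambda>j. x (i + j))"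

definition is_shift :: "(int ^ 'd \<Rightarrow> 'a::finite) set \<Rightarrow> bool" where
  "is_shift X \<longleftrightarrow>
     closedin (product_topology (\<lambda>_. discrete_topology UNIV) UNIV) X \<and>
     (\<forall>i. shift i ` X \<subseteq> X)"

definition is_sft :: "(int ^ 'd \<Rightarrow> 'a::finite) set \<Rightarrow> bool" where
  "is_sft X \<longleftrightarrow>
     is_shift X \<and>
     (\<exists>F P. finite F \<and> F \<noteq> {} \<and> P \<subseteq> (F \<rightarrow>\<^sub>E UNIV) \<and>
            X = {x. \<forall>i. restrict (shift i x) F \<in> P})"

definition lang :: "(int ^ 'd) set \<Rightarrow> (int ^ 'd \<Rightarrow> 'a::finite) set \<Rightarrow> (int ^ 'd \<Rightarrow> 'a) set" where
  "lang F X = {restrict x F | x. x \<in> X}"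

definition maxnorm :: "int ^ 'd \<Rightarrow> int" where
  "maxnorm v = Max (range (\<lambda>k. \<bar>v $ k\<bar>))"

definition cube :: "nat \<Rightarrow> (int ^ 'd) set" where
  "cube n = {i. maxnorm i \<le> int n}"

definition htop :: "(int ^ 'd \<Rightarrow> 'a::finite) set \<Rightarrow> real" where
  "htop X = lim (\<lambda>n. ln (real (card (lang (cube n) X))) / real (card (cube n :: (int ^ 'd) set)))"

definition block :: "int ^ 'd \<Rightarrow> int ^ 'd \<Rightarrow> (int ^ 'd) set" where
  "block u v = {i. \<forall>k. u $ k \<le> i $ k \<and> i $ k \<le> v $ k}"

text \<open>
  A system of local rules is a finite set of pairs \<open>(F, P)\<close> with \<open>P\<close> the set of allowed patterns
  on the shape \<open>F\<close>. The shapes are kept separate, because extendibility depends on them: a rule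
  constrains a pattern on a block only at those translates of its own shape which fit into the
  block.
\<close>

type_synonym ('a, 'd) rules = "((int ^ 'd) set \<times> (int ^ 'd \<Rightarrow> 'a) set) set"

definition given_by_rules :: "('a::finite, 'd) rules \<Rightarrow> (int ^ 'd \<Rightarrow> 'a) set \<Rightarrow> bool" where
  "given_by_rules R X \<longleftrightarrow>
     finite R \<and>
     (\<forall>(F, P) \<in> R. finite F \<and> F \<noteq> {} \<and> P \<subseteq> (F \<rightarrow>\<^sub>E UNIV)) \<and>
     X = {x. \<forall>(F, P) \<in> R. \<forall>i. restrict (shift i x) F \<in> P}"

definition violates_no_rule_in ::
    "('a::finite, 'd) rules \<Rightarrow> (int ^ 'd) set \<Rightarrow> (int ^ 'd \<Rightarrow> 'a) \<Rightarrow> bool" where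
  "violates_no_rule_in R B p \<longleftrightarrow>
     (\<forall>(F, P) \<in> R. \<forall>i. (+) i ` F \<subseteq> B \<longrightarrow> restrict (shift i p) F \<in> P)"

definition extendible :: "('a::finite, 'd) rules \<Rightarrow> (int ^ 'd \<Rightarrow> 'a) set \<Rightarrow> bool" where
  "extendible R X \<longleftrightarrow>
     given_by_rules R X \<and>
     (\<forall>u v. \<forall>p \<in> block u v \<rightarrow>\<^sub>E UNIV.
        violates_no_rule_in R (block u v) p \<longrightarrow> p \<in> lang (block u v) X)"

definition set_maxdist :: "(int ^ 'd) set \<Rightarrow> (int ^ 'd) set \<Rightarrow> int" where
  "set_maxdist A B = (INF (a, b) \<in> A \<times> B. maxnorm (a - b))"

definition cblock :: "nat \<Rightarrow> (int ^ 'd) set" where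
  "cblock m = block (\<chi> k. - int m) (\<chi> k. int m)"

definition block_strongly_irreducible :: "(int ^ 'd \<Rightarrow> 'a::finite) set \<Rightarrow> bool" where
  "block_strongly_irreducible X \<longleftrightarrow>
     (\<exists>s::nat. \<forall>i j m n.
        set_maxdist ((+) i ` cblock m) ((+) j ` cblock n) > int s \<longrightarrow>
        (\<forall>P1 \<in> lang (cblock m) X. \<forall>P2 \<in> lang (cblock n) X.
           \<exists>x \<in> X. restrict (shift i x) (cblock m) = P1 \<and>
                   restrict (shift j x) (cblock n) = P2))"

definition e1 :: "int ^ 'd::{finite,one}" where "e1 = axis 1 1"
definition e2 :: "int ^ 'd::{finite,numeral}" where "e2 = axis 2 1"
definition e3 :: "int ^ 3" where "e3 = axis 3 1"

text \<open>The isomorphism from \<open>\<int>\<^sup>2\<close> onto the sublattice \<open>L\<close> of \<open>\<int>\<^sup>3\<close> spanned by \<open>e1\<close> and \<open>e2\<close>.\<close>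

definition L_emb :: "int ^ 2 \<Rightarrow> int ^ 3" where
  "L_emb u = u $ 1 *s e1 + u $ 2 *s e2"

definition layer :: "int \<Rightarrow> (int ^ 3 \<Rightarrow> 'a) \<Rightarrow> int ^ 2 \<Rightarrow> 'a" where
  "layer n x = (\<lambda>u. x (L_emb u + n *s e3))"

definition proj_L :: "(int ^ 3 \<Rightarrow> 'a) set \<Rightarrow> (int ^ 2 \<Rightarrow> 'a) set" where
  "proj_L X = {(\<lambda>u. x (L_emb u)) | x. x \<in> X}"

definition h_L :: "(int ^ 3 \<Rightarrow> 'a::finite) set \<Rightarrow> real" where
  "h_L X = htop (proj_L X)"

definition layerwise :: "(int ^ 2 \<Rightarrow> 'a) set \<Rightarrow> (int ^ 3 \<Rightarrow> 'a) set" where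
  "layerwise Y = {x. \<forall>n. layer n x \<in> Y}"

datatype edge = ELeft | ERight | ETop | EBottom

datatype tile = T1_1 | T1_2 | T2 | T3 | T4 | T5 | T6 | T7

instance tile :: finite
proof
  have "(UNIV :: tile set) \<subseteq> {T1_1, T1_2, T2, T3, T4, T5, T6, T7}"
    using tile.exhaust by blast
  then show "finite (UNIV :: tile set)"
    by (rule finite_subset) simp
qed

fun wires :: "tile \<Rightarrow> edge set" where
  "wires T1_1 = {}"
| "wires T1_2 = {}"
| "wires T2 = {ELeft, ERight}"
| "wires T3 = {ELeft, ERight, ETop}"
| "wires T4 = {ELeft, ERight, EBottom}"
| "wires T5 = {ETop, EBottom}"
| "wires T6 = {ETop, EBottom, ERight}"
| "wires T7 = {ETop, EBottom, ELeft}"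

definition match_right :: "tile \<Rightarrow> tile \<Rightarrow> bool" where
  "match_right s t \<longleftrightarrow> (ERight \<in> wires s \<longleftrightarrow> ELeft \<in> wires t)"

definition match_top :: "tile \<Rightarrow> tile \<Rightarrow> bool" where
  "match_top s t \<longleftrightarrow> (ETop \<in> wires s \<longleftrightarrow> EBottom \<in> wires t)"

definition W2 :: "(int ^ 2 \<Rightarrow> tile) set" where
  "W2 = {w. \<forall>i. match_right (w i) (w (i + e1)) \<and> match_top (w i) (w (i + e2))}"

fun vertical_nbrs :: "tile \<Rightarrow> tile set" where
  "vertical_nbrs T1_1 = UNIV"
| "vertical_nbrs T1_2 = UNIV"
| "vertical_nbrs T2 = {T1_1, T1_2, T5}"
| "vertical_nbrs T5 = {T1_1, T1_2, T2}"
| "vertical_nbrs T3 = {T1_1, T1_2}"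
| "vertical_nbrs T4 = {T1_1, T1_2}"
| "vertical_nbrs T6 = {T1_1, T1_2}"
| "vertical_nbrs T7 = {T1_1, T1_2}"

definition W_el :: "(int ^ 3 \<Rightarrow> tile) set" where
  "W_el = {w. (\<forall>n. layer n w \<in> W2) \<and>
              (\<forall>i. w (i + e3) \<in> vertical_nbrs (w i) \<and> w (i - e3) \<in> vertical_nbrs (w i))}"

definition nn_rule :: "int ^ 'd \<Rightarrow> ('a \<Rightarrow> 'a \<Rightarrow> bool) \<Rightarrow> (int ^ 'd) set \<times> (int ^ 'd \<Rightarrow> 'a) set" where
  "nn_rule e C = ({0, e}, {p \<in> {0, e} \<rightarrow>\<^sub>E UNIV. C (p 0) (p e)})"

definition el_rules :: "(tile, 3) rules" where
  "el_rules =
     {nn_rule e1 match_right,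
      nn_rule e2 match_top,
      nn_rule e3 (\<lambda>s t. t \<in> vertical_nbrs s),
      nn_rule (- e3) (\<lambda>s t. t \<in> vertical_nbrs s)}"

end

theory Submission
  imports Defs
begin

text \<open>
  Wires of vertically adjacent tiles are disjoint. Hence a pattern on a block can be extended by
  straight wires inside its layers and by blank layers elsewhere, and for block strong
  irreducibility the wires leaving a half space are collected by straight wires in columns
  that depend on the parity of the layer. As each choice of wires at the left and bottom edges of a
  tile leaves exactly two tiles, the number of patterns on a cube is \<open>2\<close> to the volume up to a
  boundary term, and the blank tiles alone give the lower bound. So both entropies equal \<open>ln 2\<close>. The
  configuration with tile \<open>2\<close> everywhere separates the two shifts.
\<close>

section \<open>Configurations in coordinates\<close>

definition vertical_ok :: "tile \<Rightarrow> tile \<Rightarrow> bool" where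
  "vertical_ok s t \<longleftrightarrow> t \<in> vertical_nbrs s"

text \<open>The table of admissible neighbours is symmetric, so the upward rule at
  \<open>i - e3\<close> is the downward rule at \<open>i\<close>.\<close>

lemma vertical_ok_commute: "vertical_ok s t \<longleftrightarrow> vertical_ok t s"
  by (cases s; cases t) (auto simp: vertical_ok_def)

lemma vertical_ok_blank [simp]: "vertical_ok T1_1 t" "vertical_ok t T1_1" "vertical_ok T1_2 t" "vertical_ok t T1_2"
  by (cases t; auto simp: vertical_ok_def)+

text \<open>Two nonblank tiles can be stacked only as 2 and 5, whose wires run in perpendicular
  directions.\<close>

lemma vertical_ok_disjoint: "vertical_ok s t \<Longrightarrow> d \<in> wires s \<Longrightarrow> d \<notin> wires t"
  by (cases s; cases t) (auto simp: vertical_ok_def)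

text \<open>With three integer arguments instead of a vector, the constructions below become case
  distinctions in linear arithmetic.\<close>

definition el_valid :: "(int \<Rightarrow> int \<Rightarrow> int \<Rightarrow> tile) \<Rightarrow> bool" where
  "el_valid f \<longleftrightarrow> (\<forall>a b c. match_right (f a b c) (f (a + 1) b c) \<and>
     match_top (f a b c) (f a (b + 1) c) \<and> vertical_ok (f a b c) (f a b (c + 1)))"

lemma e_nth_3 [simp]:
  "(e1 :: int ^ 3) $ 1 = 1" "(e1 :: int ^ 3) $ 2 = 0" "(e1 :: int ^ 3) $ 3 = 0"
  "(e2 :: int ^ 3) $ 1 = 0" "(e2 :: int ^ 3) $ 2 = 1" "(e2 :: int ^ 3) $ 3 = 0"
  "e3 $ 1 = 0" "e3 $ 2 = 0" "e3 $ 3 = 1"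
  by (simp_all add: e1_def e2_def e3_def axis_def)

lemma W_el_iff_nbrs:
  "w \<in> W_el \<longleftrightarrow> (\<forall>i. match_right (w i) (w (i + e1)) \<and> match_top (w i) (w (i + e2)) \<and>
     vertical_ok (w i) (w (i + e3)))" (is "_ \<longleftrightarrow> ?R")
proof -
  have L: "L_emb (u + e1) = L_emb u + e1" "L_emb (u + e2) = L_emb u + e2" for u
    by (simp_all add: L_emb_def vec_eq_iff forall_3 e1_def e2_def axis_def)
  have plane: "L_emb (u + e1) + n *s e3 = L_emb u + n *s e3 + e1"
    "L_emb (u + e2) + n *s e3 = L_emb u + n *s e3 + e2" for u n
    unfolding L by (simp_all add: add_ac)
  \<comment> \<open>The layers cover the whole lattice, so a rule imposed in every layer is a rule
    at every point.\<close>
  have ex: "\<exists>u n. i = L_emb u + n *s e3" for i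
    by (rule exI[of _ "vector [i $ 1, i $ 2]"], rule exI[of _ "i $ 3"])
       (simp add: L_emb_def vec_eq_iff forall_3)
  have "(\<forall>n. layer n w \<in> W2) \<longleftrightarrow>
     (\<forall>i. match_right (w i) (w (i + e1)) \<and> match_top (w i) (w (i + e2)))"
  proof
    assume *: "\<forall>n. layer n w \<in> W2"
    show "\<forall>i. match_right (w i) (w (i + e1)) \<and> match_top (w i) (w (i + e2))"
    proof
      fix i
      obtain u n where i: "i = L_emb u + n *s e3" using ex by blast
      have "layer n w \<in> W2" using * by blast
      then have "match_right (layer n w u) (layer n w (u + e1)) \<and> match_top (layer n w u) (layer n w (u + e2))"
        by (simp add: W2_def)
      then show "match_right (w i) (w (i + e1)) \<and> match_top (w i) (w (i + e2))"
        by (simp add: layer_def plane i)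
    qed
  next
    assume *: "\<forall>i. match_right (w i) (w (i + e1)) \<and> match_top (w i) (w (i + e2))"
    show "\<forall>n. layer n w \<in> W2"
    proof
      fix n
      have "match_right (w (L_emb u + n *s e3)) (w (L_emb u + n *s e3 + e1)) \<and>
        match_top (w (L_emb u + n *s e3)) (w (L_emb u + n *s e3 + e2))" for u
        using * by blast
      then show "layer n w \<in> W2"
        by (simp add: W2_def layer_def plane)
    qed
  qed
  moreover have "(\<forall>i. w (i + e3) \<in> vertical_nbrs (w i) \<and> w (i - e3) \<in> vertical_nbrs (w i)) \<longleftrightarrow>
     (\<forall>i. vertical_ok (w i) (w (i + e3)))"
    unfolding vertical_ok_def[symmetric]
    by (metis vertical_ok_commute diff_add_cancel)
  ultimately show ?thesis unfolding W_el_def by blast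
qed

lemma W_el_coords: "el_valid f \<Longrightarrow> (\<lambda>i. f (i $ 1) (i $ 2) (i $ 3)) \<in> W_el"
  by (simp add: W_el_iff_nbrs el_valid_def)

lemma vector_3_add:
  "(vector [a + 1, b, c] :: int ^ 3) = vector [a, b, c] + e1"
  "(vector [a, b + 1, c] :: int ^ 3) = vector [a, b, c] + e2"
  "(vector [a, b, c + 1] :: int ^ 3) = vector [a, b, c] + e3"
  by (simp_all add: vec_eq_iff forall_3)

lemma el_valid_W_el: "w \<in> W_el \<Longrightarrow> el_valid (\<lambda>a b c. w (vector [a, b, c]))"
  by (simp add: W_el_iff_nbrs el_valid_def vector_3_add)

lemma vector_3_nth [simp]: "(vector [i $ 1, i $ 2, i $ 3] :: int ^ 3) = i"
  by (simp add: vec_eq_iff forall_3)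

lemma shift_W_el: "w \<in> W_el \<Longrightarrow> shift i w \<in> W_el"
  by (simp add: W_el_iff_nbrs shift_def add.assoc[symmetric])

text \<open>A blank has no wires and tolerates every vertical neighbour, so the two blanks can be
  placed freely. This freedom gives the lower bound for the entropy.\<close>

lemma blank_W_el:
  assumes "\<And>i. w i \<in> {T1_1, T1_2}"
  shows "w \<in> W_el"
proof -
  have "w i = T1_1 \<or> w i = T1_2" for i using assms by auto
  then have "wires (w i) = {}" "vertical_ok (w i) t" for i t
    by (metis wires.simps(1,2), metis vertical_ok_blank)
  then show ?thesis by (simp add: W_el_iff_nbrs match_right_def match_top_def)
qed

section \<open>Finite type\<close>

text \<open>A forbidden pattern is already visible on a finite window, so the complement is open.
  Invariance holds because the condition ranges over all translates.\<close>

lemma is_sft_of_patterns: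
  fixes X :: "(int ^ 'd \<Rightarrow> 'a::finite) set"
  assumes F: "finite F" "F \<noteq> {}" and P: "P \<subseteq> F \<rightarrow>\<^sub>E UNIV"
    and X: "X = {x. \<forall>i. restrict (shift i x) F \<in> P}"
  shows "is_sft X"
proof -
  let ?T = "product_topology (\<lambda>_. discrete_topology UNIV) UNIV :: (int ^ 'd \<Rightarrow> 'a) topology"
  have top: "topspace ?T = UNIV" by (simp add: PiE_UNIV_domain)
  have "openin ?T (- X)"
  proof (subst openin_subopen, intro ballI)
    fix x assume "x \<in> - X"
    then obtain i where i: "restrict (shift i x) F \<notin> P" using X by auto
    \<comment> \<open>The cylinder of all configurations that agree with \<open>x\<close> on the
      offending window.\<close>
    let ?S = "\<lambda>j. if j \<in> (+) i ` F then {x j} else UNIV"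
    have "openin ?T (PiE UNIV ?S)"
    proof (rule product_topology_basis)
      have "{j. ?S j \<noteq> topspace (discrete_topology UNIV)} \<subseteq> (+) i ` F" by auto
      then show "finite {j. ?S j \<noteq> topspace (discrete_topology UNIV)}"
        using F finite_subset by blast
    qed simp
    moreover have "x \<in> PiE UNIV ?S" by (auto simp: PiE_UNIV_domain)
    moreover have "PiE UNIV ?S \<subseteq> - X"
    proof
      fix y assume "y \<in> PiE UNIV ?S"
      then have "y j \<in> ?S j" for j by (rule PiE_mem) (rule UNIV_I)
      then have "y (i + j) = x (i + j)" if "j \<in> F" for j using that
        by (metis image_eqI singletonD)
      then have "restrict (shift i y) F = restrict (shift i x) F"
        by (simp add: shift_def restrict_def fun_eq_iff)
      then have "restrict (shift i y) F \<notin> P" using i by simp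
      then show "y \<in> - X" unfolding X by blast
    qed
    ultimately show "\<exists>T. openin ?T T \<and> x \<in> T \<and> T \<subseteq> - X" by blast
  qed
  then have "closedin ?T X" by (simp add: closedin_def top Compl_eq_Diff_UNIV)
  moreover have "shift i ` X \<subseteq> X" for i
  proof -
    have "shift j (shift i x) = shift (i + j) x" for j and x :: "int ^ 'd \<Rightarrow> 'a"
      by (simp add: shift_def add.assoc)
    then show ?thesis by (auto simp: X)
  qed
  ultimately show ?thesis
    unfolding is_sft_def is_shift_def using F P X by blast
qed

lemma is_sft_W_el: "is_sft W_el"
proof (rule is_sft_of_patterns)
  let ?F = "{0, e1, e2, e3} :: (int ^ 3) set"
  let ?P = "{p \<in> ?F \<rightarrow>\<^sub>E UNIV. match_right (p 0) (p e1) \<and> match_top (p 0) (p e2) \<and> vertical_ok (p 0) (p e3)}"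
  show "finite ?F" "?F \<noteq> {}" "?P \<subseteq> ?F \<rightarrow>\<^sub>E UNIV" by auto
  show "W_el = {x. \<forall>i. restrict (shift i x) ?F \<in> ?P}"
    by (auto simp: W_el_iff_nbrs shift_def)
qed

section \<open>Extendibility\<close>

text \<open>Layers outside the block are blank. Inside a layer, wires leaving through the lower or
  upper side run on as vertical lines of tile 5, and those leaving through the left or right side as
  horizontal lines of tile 2. These lines never meet, because the four corner regions are
  blank.\<close>

definition extension :: "int ^ 3 \<Rightarrow> int ^ 3 \<Rightarrow> (int \<Rightarrow> int \<Rightarrow> int \<Rightarrow> tile) \<Rightarrow> int \<Rightarrow> int \<Rightarrow> int \<Rightarrow> tile" where
  "extension u v f a b c =
    (if c < u $ 3 \<or> v $ 3 < c then T1_1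
     else if u $ 1 \<le> a \<and> a \<le> v $ 1 then
       (if b < u $ 2 then (if EBottom \<in> wires (f a (u $ 2) c) then T5 else T1_1)
        else if v $ 2 < b then (if ETop \<in> wires (f a (v $ 2) c) then T5 else T1_1)
        else f a b c)
     else if b < u $ 2 \<or> v $ 2 < b then T1_1
     else if a < u $ 1 then (if ELeft \<in> wires (f (u $ 1) b c) then T2 else T1_1)
     else (if ERight \<in> wires (f (v $ 1) b c) then T2 else T1_1))"

text \<open>Straight wires leaving the block in adjacent layers never lie on top of each other, since
  vertically adjacent tiles have disjoint wires.\<close>

lemma el_valid_extension:
  assumes ne: "\<And>k. u $ k \<le> v $ k"
    and mr: "\<And>a b c. \<lbrakk>u $ 1 \<le> a; a + 1 \<le> v $ 1; u $ 2 \<le> b; b \<le> v $ 2; u $ 3 \<le> c; c \<le> v $ 3\<rbrakk>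
      \<Longrightarrow> match_right (f a b c) (f (a + 1) b c)"
    and mt: "\<And>a b c. \<lbrakk>u $ 1 \<le> a; a \<le> v $ 1; u $ 2 \<le> b; b + 1 \<le> v $ 2; u $ 3 \<le> c; c \<le> v $ 3\<rbrakk>
      \<Longrightarrow> match_top (f a b c) (f a (b + 1) c)"
    and vo: "\<And>a b c. \<lbrakk>u $ 1 \<le> a; a \<le> v $ 1; u $ 2 \<le> b; b \<le> v $ 2; u $ 3 \<le> c; c + 1 \<le> v $ 3\<rbrakk>
      \<Longrightarrow> vertical_ok (f a b c) (f a b (c + 1))"
  shows "el_valid (extension u v f)"
  unfolding el_valid_def
proof (intro allI conjI)
  fix a b c
  let ?g = "extension u v f"
  note ne' = ne[of 1] ne[of 2] ne[of 3]
  consider "c < u $ 3 \<or> v $ 3 < c" | "u $ 3 \<le> c \<and> c \<le> v $ 3" "u $ 2 \<le> b \<and> b \<le> v $ 2"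
    | "u $ 3 \<le> c \<and> c \<le> v $ 3" "b < u $ 2 \<or> v $ 2 < b" by linarith
  then show "match_right (?g a b c) (?g (a + 1) b c)"
  proof cases
    case 2
    consider "a < u $ 1 - 1" | "a = u $ 1 - 1" | "u $ 1 \<le> a" "a < v $ 1" | "a = v $ 1" | "v $ 1 < a"
      by linarith
    then show ?thesis using 2 ne' mr[of a b c]
      by cases (auto simp: extension_def match_right_def)
  qed (auto simp: extension_def match_right_def)
  consider "c < u $ 3 \<or> v $ 3 < c" | "u $ 3 \<le> c \<and> c \<le> v $ 3" "u $ 1 \<le> a \<and> a \<le> v $ 1"
    | "u $ 3 \<le> c \<and> c \<le> v $ 3" "a < u $ 1 \<or> v $ 1 < a" by linarith
  then show "match_top (?g a b c) (?g a (b + 1) c)"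
  proof cases
    case 2
    consider "b < u $ 2 - 1" | "b = u $ 2 - 1" | "u $ 2 \<le> b" "b < v $ 2" | "b = v $ 2" | "v $ 2 < b"
      by linarith
    then show ?thesis using 2 ne' mt[of a b c]
      by cases (auto simp: extension_def match_top_def)
  qed (auto simp: extension_def match_top_def)
  show "vertical_ok (?g a b c) (?g a b (c + 1))"
  \<comment> \<open>If one of the two layers misses the block, it is blank. Otherwise the straight
    lines reduce to the boundary tiles that emit them.\<close>
  proof (cases "u $ 3 \<le> c \<and> c + 1 \<le> v $ 3")
    case False
    then have "?g a b c = T1_1 \<or> ?g a b (c + 1) = T1_1"
      unfolding extension_def by auto
    then show ?thesis by auto
  next
    case True
    then show ?thesis using vo[of a b c] ne'
        vertical_ok_disjoint[OF vo[of a "u $ 2" c], of EBottom]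
        vertical_ok_disjoint[OF vo[of a "v $ 2" c], of ETop]
        vertical_ok_disjoint[OF vo[of "u $ 1" b c], of ELeft]
        vertical_ok_disjoint[OF vo[of "v $ 1" b c], of ERight]
      by (auto simp: extension_def)
  qed
qed

text \<open>Each rule has a shape of just two cells, so it constrains every pair of neighbours
  inside the block, including those lying along a face.\<close>

lemma violates_no_rule_nn:
  assumes "violates_no_rule_in R B p" "nn_rule e C \<in> R" "i \<in> B" "i + e \<in> B"
  shows "C (p i) (p (i + e))"
proof -
  have "(+) i ` {0, e} \<subseteq> B" using assms by auto
  then have "restrict (shift i p) {0, e} \<in> {p \<in> {0, e} \<rightarrow>\<^sub>E UNIV. C (p 0) (p e)}"
    using bspec[OF assms(1)[unfolded violates_no_rule_in_def] assms(2)[unfolded nn_rule_def]]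
    unfolding prod.case by blast
  then show ?thesis by (simp add: shift_def)
qed

lemma given_by_el_rules: "given_by_rules el_rules W_el"
proof -
  have nn: "restrict (shift i x) {0, e} \<in> {p \<in> {0, e} \<rightarrow>\<^sub>E UNIV. C (p 0) (p e)} \<longleftrightarrow> C (x i) (x (i + e))"
    for i e and x :: "int ^ 3 \<Rightarrow> tile" and C
    by (simp add: shift_def)
  have "x \<in> W_el \<longleftrightarrow> (\<forall>(F, P) \<in> el_rules. \<forall>i. restrict (shift i x) F \<in> P)" for x
  proof -
    have "(\<forall>(F, P) \<in> el_rules. \<forall>i. restrict (shift i x) F \<in> P) \<longleftrightarrow>
       (\<forall>i. match_right (x i) (x (i + e1))) \<and> (\<forall>i. match_top (x i) (x (i + e2))) \<and>
       (\<forall>i. vertical_ok (x i) (x (i + e3))) \<and> (\<forall>i. vertical_ok (x i) (x (i - e3)))"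
      unfolding el_rules_def nn_rule_def ball_simps prod.case nn vertical_ok_def by (simp add: shift_def)
    moreover have "(\<forall>i. vertical_ok (x i) (x (i + e3))) \<Longrightarrow> (\<forall>i. vertical_ok (x i) (x (i - e3)))"
      by (metis vertical_ok_commute diff_add_cancel)
    ultimately show ?thesis unfolding W_el_iff_nbrs by blast
  qed
  then have "W_el = {x. \<forall>(F, P) \<in> el_rules. \<forall>i. restrict (shift i x) F \<in> P}" by blast
  moreover have "finite el_rules" by (simp add: el_rules_def)
  moreover have "\<forall>(F, P) \<in> el_rules. finite F \<and> F \<noteq> {} \<and> P \<subseteq> (F \<rightarrow>\<^sub>E UNIV)"
    by (auto simp: el_rules_def nn_rule_def)
  ultimately show ?thesis by (simp add: given_by_rules_def)
qed

lemma extendible_W_el: "extendible el_rules W_el"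
  unfolding extendible_def
proof (intro conjI allI ballI impI given_by_el_rules)
  fix u v :: "int ^ 3" and p :: "int ^ 3 \<Rightarrow> tile"
  assume p: "p \<in> block u v \<rightarrow>\<^sub>E UNIV" and nv: "violates_no_rule_in el_rules (block u v) p"
  have "\<exists>x \<in> W_el. \<forall>i \<in> block u v. x i = p i"
  \<comment> \<open>\<open>extension\<close> reads the tiles on the faces of the block, which must
    therefore exist.\<close>
  proof (cases "block u v = {}")
    case True
    then show ?thesis using blank_W_el[of "\<lambda>_. T1_1"] by auto
  next
    case False
    let ?f = "\<lambda>a b c. p (vector [a, b, c])"
    have ne: "u $ k \<le> v $ k" for k
      using False unfolding block_def by (auto intro: order.trans)
    have blk: "vector [a, b, c] \<in> block u v \<longleftrightarrow>
      u $ 1 \<le> a \<and> a \<le> v $ 1 \<and> u $ 2 \<le> b \<and> b \<le> v $ 2 \<and> u $ 3 \<le> c \<and> c \<le> v $ 3" for a b c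
      by (auto simp: block_def forall_3)
    have "nn_rule e1 match_right \<in> el_rules" "nn_rule e2 match_top \<in> el_rules"
      "nn_rule e3 vertical_ok \<in> el_rules"
      by (auto simp: el_rules_def vertical_ok_def[abs_def])
    note rules = this[THEN violates_no_rule_nn[OF nv]]
    have "match_right (?f a b c) (?f (a + 1) b c)"
      if "vector [a, b, c] \<in> block u v" "vector [a + 1, b, c] \<in> block u v" for a b c
      using rules(1) that by (simp only: vector_3_add)
    moreover have "match_top (?f a b c) (?f a (b + 1) c)"
      if "vector [a, b, c] \<in> block u v" "vector [a, b + 1, c] \<in> block u v" for a b c
      using rules(2) that by (simp only: vector_3_add)
    moreover have "vertical_ok (?f a b c) (?f a b (c + 1))"
      if "vector [a, b, c] \<in> block u v" "vector [a, b, c + 1] \<in> block u v" for a b c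
      using rules(3) that by (simp only: vector_3_add)
    ultimately have "el_valid (extension u v ?f)"
      by (intro el_valid_extension ne) (simp_all add: blk)
    then have "(\<lambda>i. extension u v ?f (i $ 1) (i $ 2) (i $ 3)) \<in> W_el"
      by (rule W_el_coords)
    moreover have "extension u v ?f (i $ 1) (i $ 2) (i $ 3) = p i" if "i \<in> block u v" for i
    proof -
      have "u $ k \<le> i $ k \<and> i $ k \<le> v $ k" for k using that by (simp add: block_def)
      from this[of 1] this[of 2] this[of 3] show ?thesis by (simp add: extension_def not_less)
    qed
    ultimately show ?thesis
      by (intro bexI[of _ "\<lambda>i. extension u v ?f (i $ 1) (i $ 2) (i $ 3)"] ballI)
  qed
  then obtain x where x: "x \<in> W_el" "\<forall>i \<in> block u v. x i = p i" by (rule bexE)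
  have "p = restrict x (block u v)"
    by (rule extensionalityI[of _ "block u v"]) (use p x(2) in \<open>simp_all add: PiE_def\<close>)
  then show "p \<in> lang (block u v) W_el" using x(1) by (auto simp: lang_def)
qed

section \<open>Block strong irreducibility\<close>

text \<open>All wires crossing out of a half space end in one of two infinite straight wires parallel to
  its boundary, the first for the even layers and the second for the odd ones. The wires of an odd
  layer pass over the straight wire of an even one only at places where the latter has no junction.\<close>

definition glue1 :: "int \<Rightarrow> (int \<Rightarrow> int \<Rightarrow> int \<Rightarrow> tile) \<Rightarrow> (int \<Rightarrow> int \<Rightarrow> int \<Rightarrow> tile)
    \<Rightarrow> int \<Rightarrow> int \<Rightarrow> int \<Rightarrow> tile" where
  "glue1 m f g a b c =
    (if a \<le> m then f a b c
     else if m + 5 \<le> a then g a b c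
     else if a = m + 1 then
       (if even c then (if ERight \<in> wires (f m b c) then T7 else T5)
        else (if ERight \<in> wires (f m b c) then T2 else T1_1))
     else if a = m + 2 then
       (if even c then T1_1 else (if ERight \<in> wires (f m b c) then T7 else T5))
     else if a = m + 3 then
       (if even c then T1_1 else (if ELeft \<in> wires (g (m + 5) b c) then T6 else T5))
     else
       (if even c then (if ELeft \<in> wires (g (m + 5) b c) then T6 else T5)
        else (if ELeft \<in> wires (g (m + 5) b c) then T2 else T1_1)))"

lemma el_valid_glue1:
  assumes f: "el_valid f" and g: "el_valid g"
  shows "el_valid (glue1 m f g)"
  unfolding el_valid_def
proof (intro allI)
  fix a b c
  have F: "match_right (f a b c) (f (a + 1) b c)" "match_top (f a b c) (f a (b + 1) c)"
    "vertical_ok (f a b c) (f a b (c + 1))" for a b c using f by (auto simp: el_valid_def)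
  have G: "match_right (g a b c) (g (a + 1) b c)" "match_top (g a b c) (g a (b + 1) c)"
    "vertical_ok (g a b c) (g a b (c + 1))" for a b c using g by (auto simp: el_valid_def)
  \<comment> \<open>A junction in column \<open>m + 1\<close> or \<open>m + 4\<close> of an even
    layer sits exactly where a wire arrives. By disjointness no wire arrives there in the adjacent
    odd layers, which have a blank at that place. In columns \<open>m + 2\<close> and
    \<open>m + 3\<close> the even layers are blank.\<close>
  have D: "ERight \<in> wires (f m b c) \<Longrightarrow> ERight \<notin> wires (f m b (c + 1))"
    "ELeft \<in> wires (g (m + 5) b c) \<Longrightarrow> ELeft \<notin> wires (g (m + 5) b (c + 1))"
    using vertical_ok_disjoint[OF F(3)] vertical_ok_disjoint[OF G(3)] by blast+
  have [simp]: "5 + m = m + 5" by simp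
  let ?h = "glue1 m f g"
  \<comment> \<open>Columns \<open>m + 1\<close> and \<open>m + 2\<close> absorb the wires of
    \<open>f\<close>, and columns \<open>m + 3\<close> and \<open>m + 4\<close> those of
    \<open>g\<close>, in mirror image.\<close>
  consider "a < m" | "a = m" | "a = m + 1" | "a = m + 2" | "a = m + 3" | "a = m + 4" | "m + 5 \<le> a"
    by linarith
  note cases = this
  from cases have "match_right (?h a b c) (?h (a + 1) b c)"
  proof cases
    case 1 then show ?thesis using F(1)[of a b c] by (simp add: glue1_def)
  next
    case 7 then show ?thesis using G(1)[of a b c] by (simp add: glue1_def)
  qed (simp_all add: glue1_def match_right_def)
  moreover from cases have "match_top (?h a b c) (?h a (b + 1) c)"
  proof cases
    case 1 then show ?thesis using F(2)[of a b c] by (simp add: glue1_def)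
  next
    case 2 then show ?thesis using F(2)[of a b c] by (simp add: glue1_def)
  next
    case 7 then show ?thesis using G(2)[of a b c] by (simp add: glue1_def)
  qed (simp_all add: glue1_def match_top_def)
  moreover from cases have "vertical_ok (?h a b c) (?h a b (c + 1))"
  proof cases
    case 1 then show ?thesis using F(3)[of a b c] by (simp add: glue1_def)
  next
    case 2 then show ?thesis using F(3)[of a b c] by (simp add: glue1_def)
  next
    case 7 then show ?thesis using G(3)[of a b c] by (simp add: glue1_def)
  qed (use D in \<open>auto simp: glue1_def vertical_ok_def\<close>)
  ultimately show "match_right (?h a b c) (?h (a + 1) b c) \<and> match_top (?h a b c) (?h a (b + 1) c) \<and>
     vertical_ok (?h a b c) (?h a b (c + 1))" by blast
qed

text \<open>Reflection at the diagonal exchanges left with bottom and right with top.\<close>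

fun transpose_tile :: "tile \<Rightarrow> tile" where
  "transpose_tile T1_1 = T1_1"
| "transpose_tile T1_2 = T1_2"
| "transpose_tile T2 = T5"
| "transpose_tile T3 = T6"
| "transpose_tile T4 = T7"
| "transpose_tile T5 = T2"
| "transpose_tile T6 = T3"
| "transpose_tile T7 = T4"

lemma transpose_tile_idem [simp]: "transpose_tile (transpose_tile t) = t"
  by (cases t) auto

text \<open>Transposition exchanges the two horizontal rules and swaps tiles 2 and 5, which keeps
  the vertical rule. It reduces gluing along \<open>e2\<close> to gluing along
  \<open>e1\<close>.\<close>

lemma el_valid_transpose:
  assumes "el_valid f"
  shows "el_valid (\<lambda>a b c. transpose_tile (f b a c))"
proof -
  have "match_right (transpose_tile s) (transpose_tile t) = match_top s t"
    "match_top (transpose_tile s) (transpose_tile t) = match_right s t"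
    "vertical_ok (transpose_tile s) (transpose_tile t) = vertical_ok s t" for s t
    by (cases s; cases t; simp add: match_right_def match_top_def vertical_ok_def)+
  then show ?thesis using assms by (simp add: el_valid_def)
qed

text \<open>The gap of 5 leaves room for the four collecting columns of \<open>glue1\<close> in both
  horizontal directions. In the vertical direction a single blank layer decouples the two
  sides.\<close>

lemma glue_half_spaces:
  assumes x: "x \<in> W_el" and y: "y \<in> W_el"
  shows "\<exists>z \<in> W_el. \<forall>i. (i $ k \<le> m \<longrightarrow> z i = x i) \<and> (m + 5 \<le> i $ k \<longrightarrow> z i = y i)"
proof -
  define f where "f = (\<lambda>a b c. x (vector [a, b, c]))"
  define g where "g = (\<lambda>a b c. y (vector [a, b, c]))"
  have fg: "el_valid f" "el_valid g" using x y by (simp_all add: f_def g_def el_valid_W_el)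
  have xy: "f (i $ 1) (i $ 2) (i $ 3) = x i" "g (i $ 1) (i $ 2) (i $ 3) = y i" for i
    by (simp_all add: f_def g_def)
  consider "k = 1" | "k = 2" | "k = 3" using exhaust_3 by blast
  then show ?thesis
  proof cases
    case 1
    show ?thesis
      by (rule bexI[OF _ W_el_coords[OF el_valid_glue1[OF fg, of m]]]) (simp add: 1 glue1_def xy)
  next
    case 2
    let ?t = "\<lambda>f a b c. transpose_tile (f b a c)"
    show ?thesis
      by (rule bexI[OF _ W_el_coords[OF el_valid_transpose[OF el_valid_glue1[OF fg[THEN el_valid_transpose], of m]]]])
         (simp add: 2 glue1_def xy)
  next
    case 3
    let ?h = "\<lambda>a b c. if c \<le> m then f a b c else if m + 2 \<le> c then g a b c else T1_1"
    have "el_valid ?h" unfolding el_valid_def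
    proof (intro allI)
      fix a b c
      consider "c < m" | "c = m" | "c = m + 1" | "m + 2 \<le> c" by linarith
      then show "match_right (?h a b c) (?h (a + 1) b c) \<and> match_top (?h a b c) (?h a (b + 1) c) \<and>
         vertical_ok (?h a b c) (?h a b (c + 1))"
        using fg by cases (auto simp: el_valid_def match_right_def match_top_def)
    qed
    from W_el_coords[OF this] show ?thesis
      by (rule bexI[rotated]) (simp add: 3 xy)
  qed
qed

lemma maxnorm_le_iff: "maxnorm v \<le> r \<longleftrightarrow> (\<forall>k. \<bar>v $ k\<bar> \<le> r)"
  by (simp add: maxnorm_def)

lemma maxnorm_nonneg: "0 \<le> maxnorm v"
  using maxnorm_le_iff[of v "maxnorm v"] by (meson abs_ge_zero order.trans order_refl)

text \<open>In the maximum metric close points can be chosen coordinate by coordinate. If all pairs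
  of coordinate intervals were within distance \<open>s\<close>, these choices would assemble to
  points of the two cubes at distance at most \<open>s\<close>.\<close>

lemma cblock_separated:
  fixes i j :: "int ^ 'd"
  assumes "set_maxdist ((+) i ` cblock m) ((+) j ` cblock n) > int s"
  obtains k where "i $ k + int m + int s < j $ k - int n"
  | k where "j $ k + int n + int s < i $ k - int m"
proof -
  have "\<exists>k. i $ k + int m + int s < j $ k - int n \<or> j $ k + int n + int s < i $ k - int m"
  proof (rule ccontr)
    assume "\<not> ?thesis"
    then have gap: "j $ k - int n \<le> i $ k + int m + int s" "i $ k - int m \<le> j $ k + int n + int s" for k
      by (force simp: not_less)+
    have "\<exists>a b. \<bar>a\<bar> \<le> int m \<and> \<bar>b\<bar> \<le> int n \<and> \<bar>i $ k + a - (j $ k + b)\<bar> \<le> int s" for k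
    proof -
      define d where "d = j $ k - i $ k"
      have d: "d \<le> int m + int n + int s" "- d \<le> int m + int n + int s"
        using gap[of k] by (simp_all add: d_def)
      consider "d < - int m - int n" | "- int m - int n \<le> d" "d < - int m" | "\<bar>d\<bar> \<le> int m"
        | "int m < d" "d \<le> int m + int n" | "int m + int n < d" by linarith
      \<comment> \<open>In the outer two cases the intervals are disjoint and their facing endpoints
        are taken. In the other three they meet and a common point is taken.\<close>
      then have "\<exists>a b. \<bar>a\<bar> \<le> int m \<and> \<bar>b\<bar> \<le> int n \<and> \<bar>a - b - d\<bar> \<le> int s"
      proof cases
        case 1 then show ?thesis using d by (intro exI[of _ "- int m"] exI[of _ "int n"]) auto
      next
        case 2 then show ?thesis by (intro exI[of _ "- int m"] exI[of _ "- int m - d"]) auto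
      next
        case 3 then show ?thesis by (intro exI[of _ d] exI[of _ 0]) auto
      next
        case 4 then show ?thesis by (intro exI[of _ "int m"] exI[of _ "int m - d"]) auto
      next
        case 5 then show ?thesis using d by (intro exI[of _ "int m"] exI[of _ "- int n"]) auto
      qed
      then show ?thesis by (simp add: d_def algebra_simps)
    qed
    then obtain a b where ab: "\<And>k. \<bar>a k\<bar> \<le> int m" "\<And>k. \<bar>b k\<bar> \<le> int n"
      "\<And>k. \<bar>i $ k + a k - (j $ k + b k)\<bar> \<le> int s" by metis
    have "- int m \<le> a k" "a k \<le> int m" "- int n \<le> b k" "b k \<le> int n" for k
      using ab(1,2)[of k] by linarith+
    then have "vec_lambda a \<in> cblock m" "vec_lambda b \<in> cblock n"
      by (simp_all add: cblock_def block_def)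
    then have mem: "(i + vec_lambda a, j + vec_lambda b) \<in> ((+) i ` cblock m) \<times> ((+) j ` cblock n)"
      by blast
    \<comment> \<open>The infimum over the integers is only conditionally complete, so a lower bound
      is required.\<close>
    have "bdd_below ((\<lambda>(a, b). maxnorm (a - b)) ` (((+) i ` cblock m) \<times> ((+) j ` cblock n)))"
      by (rule bdd_belowI[of _ 0]) (auto simp: maxnorm_nonneg)
    from cINF_lower[OF this mem]
    have "set_maxdist ((+) i ` cblock m) ((+) j ` cblock n) \<le> maxnorm (i + vec_lambda a - (j + vec_lambda b))"
      by (simp add: set_maxdist_def)
    also have "\<dots> \<le> int s" using ab(3) by (simp add: maxnorm_le_iff)
    finally show False using assms by simp
  qed
  then show ?thesis using that by blast
qed

lemma block_strongly_irreducible_W_el: "block_strongly_irreducible W_el"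
  unfolding block_strongly_irreducible_def
proof (intro exI[of _ 5] allI impI ballI)
  fix i j :: "int ^ 3" and m n P1 P2
  assume dist: "set_maxdist ((+) i ` cblock m) ((+) j ` cblock n) > int 5"
    and "P1 \<in> lang (cblock m) W_el" "P2 \<in> lang (cblock n) W_el"
  then obtain x y where x: "x \<in> W_el" "P1 = restrict x (cblock m)"
    and y: "y \<in> W_el" "P2 = restrict y (cblock n)" by (auto simp: lang_def)
  \<comment> \<open>The patterns are given around the origin; these shifts carry them to their
    places around \<open>i\<close> and \<open>j\<close>.\<close>
  let ?x = "shift (- i) x" and ?y = "shift (- j) y"
  have xy: "?x \<in> W_el" "?y \<in> W_el" using x y by (auto intro: shift_W_el)
  have bd: "- int m \<le> l $ k \<and> l $ k \<le> int m" if "l \<in> cblock m" for l :: "int ^ 3" and m k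
    using that by (simp add: cblock_def block_def)
  have "\<exists>z \<in> W_el. (\<forall>l \<in> cblock m. z (i + l) = ?x (i + l)) \<and> (\<forall>l \<in> cblock n. z (j + l) = ?y (j + l))"
    using dist
  proof (cases rule: cblock_separated)
    case (1 k)
    obtain z where z: "z \<in> W_el" "\<And>l. l $ k \<le> i $ k + int m \<Longrightarrow> z l = ?x l"
      "\<And>l. i $ k + int m + 5 \<le> l $ k \<Longrightarrow> z l = ?y l"
      using glue_half_spaces[OF xy] by blast
    have "z (i + l) = ?x (i + l)" if "l \<in> cblock m" for l
      using bd[OF that, of k] by (intro z) simp
    moreover have "z (j + l) = ?y (j + l)" if "l \<in> cblock n" for l
      using bd[OF that, of k] 1 by (intro z) simp
    ultimately show ?thesis using z(1) by blast
  next
    case (2 k)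
    \<comment> \<open>Here the cube around \<open>j\<close> is on the lower side, so the two
      configurations exchange roles.\<close>
    obtain z where z: "z \<in> W_el" "\<And>l. l $ k \<le> j $ k + int n \<Longrightarrow> z l = ?y l"
      "\<And>l. j $ k + int n + 5 \<le> l $ k \<Longrightarrow> z l = ?x l"
      using glue_half_spaces[OF xy(2,1)] by blast
    have "z (j + l) = ?y (j + l)" if "l \<in> cblock n" for l
      using bd[OF that, of k] by (intro z) simp
    moreover have "z (i + l) = ?x (i + l)" if "l \<in> cblock m" for l
      using bd[OF that, of k] 2 by (intro z) simp
    ultimately show ?thesis using z(1) by blast
  qed
  then obtain z where "z \<in> W_el" "\<forall>l \<in> cblock m. z (i + l) = ?x (i + l)"
    "\<forall>l \<in> cblock n. z (j + l) = ?y (j + l)" by blast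
  then show "\<exists>x \<in> W_el. restrict (shift i x) (cblock m) = P1 \<and> restrict (shift j x) (cblock n) = P2"
    unfolding x(2) y(2) by (intro bexI[of _ z]) (auto simp: shift_def restrict_def fun_eq_iff)
qed

section \<open>Entropy\<close>

text \<open>For each choice of wires at the left and bottom edges there are exactly two tiles;
  they are told apart by this bit.\<close>

definition tile_bit :: "tile \<Rightarrow> bool" where
  "tile_bit t \<longleftrightarrow> t \<in> {T1_2, T3, T6, T7}"

text \<open>The tiles with equal left and bottom wires form the pairs 1_1 and 1_2, 2 and 3, 5 and 6,
  4 and 7; the bit is set on the second of each pair.\<close>

lemma tile_eqI:
  assumes "tile_bit s \<longleftrightarrow> tile_bit t" "ELeft \<in> wires s \<longleftrightarrow> ELeft \<in> wires t"
    "EBottom \<in> wires s \<longleftrightarrow> EBottom \<in> wires t"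
  shows "s = t"
  using assms by (cases s; cases t; simp add: tile_bit_def)

lemma cart_box_eq: "{i :: int ^ 'd. \<forall>k. i $ k \<in> A k} = vec_lambda ` PiE UNIV A"
proof (intro equalityI subsetI)
  fix i :: "int ^ 'd" assume "i \<in> {i. \<forall>k. i $ k \<in> A k}"
  then show "i \<in> vec_lambda ` PiE UNIV A"
    by (intro image_eqI[of _ _ "vec_nth i"]) auto
qed auto

lemma finite_cart_box: "(\<And>k. finite (A k)) \<Longrightarrow> finite {i :: int ^ 'd. \<forall>k. i $ k \<in> A k}"
  by (simp add: cart_box_eq finite_PiE)

lemma card_cart_box: "card {i :: int ^ 'd. \<forall>k. i $ k \<in> A k} = (\<Prod>k\<in>UNIV. card (A k))"
proof -
  have "inj_on vec_lambda (PiE UNIV A)" by (auto simp: inj_on_def vec_lambda_inject)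
  then show ?thesis by (simp add: cart_box_eq card_image card_PiE)
qed

lemma cube_eq_box: "cube n = {i. \<forall>k. i $ k \<in> {- int n .. int n}}"
proof -
  have "\<bar>a\<bar> \<le> int n \<longleftrightarrow> a \<in> {- int n .. int n}" for a by auto
  then show ?thesis by (simp only: cube_def maxnorm_le_iff)
qed

lemma finite_cube: "finite (cube n)"
  unfolding cube_eq_box by (rule finite_cart_box) simp

lemma zero_in_cube: "0 \<in> cube n"
  by (simp add: cube_eq_box)

definition cube_face :: "nat \<Rightarrow> 'd \<Rightarrow> (int ^ 'd) set" where
  "cube_face n k = {i \<in> cube n. i $ k = - int n}"

text \<open>The cube is a face times an interval of \<open>2 * n + 1\<close> integers, so faces have
  vanishing density.\<close>

lemma card_cube_face: "card (cube_face n k) * (2 * n + 1) = card (cube n :: (int ^ 'd) set)"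
  for k :: "'d::finite"
proof -
  let ?A = "\<lambda>j. if j = k then {- int n} else {- int n .. int n}"
  have "a \<in> ?A j \<longleftrightarrow> a \<in> {- int n .. int n} \<and> (j = k \<longrightarrow> a = - int n)" for a j by auto
  then have "cube_face n k = {i. \<forall>j. i $ j \<in> ?A j}"
    unfolding cube_face_def cube_eq_box by blast
  then have "card (cube_face n k) = (\<Prod>j\<in>UNIV. card (?A j))" by (simp only: card_cart_box)
  also have "\<dots> = (\<Prod>j\<in>UNIV - {k}. 2 * n + 1)"
    by (subst prod.remove[of _ k]) (simp_all add: nat_add_distrib nat_mult_distrib)
  finally have "card (cube_face n k) * (2 * n + 1) = (\<Prod>j\<in>(UNIV :: 'd set). 2 * n + 1)"
    by (subst prod.remove[of _ k]) auto
  also have "\<dots> = card (cube n :: (int ^ 'd) set)"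
    unfolding cube_eq_box card_cart_box by (intro prod.cong) auto
  finally show ?thesis .
qed

text \<open>Each subset of the cube gives its own pattern, with one blank on the subset and the
  other blank off it.\<close>

lemma card_lang_lower:
  fixes X :: "((int, 'd::finite) vec \<Rightarrow> tile) set"
  assumes blank: "\<And>x. (\<And>i. x i \<in> {T1_1, T1_2}) \<Longrightarrow> x \<in> X"
  shows "2 ^ card (cube n :: (int ^ 'd) set) \<le> card (lang (cube n) X)"
proof -
  let ?C = "cube n :: (int ^ 'd) set"
  let ?h = "\<lambda>A. restrict (\<lambda>i. if i \<in> A then T1_1 else T1_2) ?C"
  have "inj_on ?h (Pow ?C)"
  proof (rule inj_onI)
    fix A B assume AB: "A \<in> Pow ?C" "B \<in> Pow ?C" and eq: "?h A = ?h B"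
    have "i \<in> A \<longleftrightarrow> i \<in> B" if "i \<in> ?C" for i
      using fun_cong[OF eq, of i] that by (auto split: if_splits)
    then show "A = B" using AB by blast
  qed
  moreover have "?h ` Pow ?C \<subseteq> lang ?C X"
    using blank by (auto simp: lang_def)
  moreover have "finite (lang ?C X)"
    by (rule finite_subset[of _ "?C \<rightarrow>\<^sub>E UNIV"]) (auto simp: lang_def finite_cube intro!: finite_PiE)
  ultimately have "card (Pow ?C) \<le> card (lang ?C X)" by (rule card_inj_on_le)
  then show ?thesis by (simp add: card_Pow finite_cube)
qed

text \<open>The left and lower neighbours of a tile fix its left and bottom wires, and the bit then
  fixes the tile. A pattern is thus determined by its bits and its tiles on two faces.\<close>

lemma card_lang_upper:
  fixes X :: "((int, 'd::{finite,numeral}) vec \<Rightarrow> tile) set"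
  assumes X: "\<And>x i. x \<in> X \<Longrightarrow> match_right (x i) (x (i + e1)) \<and> match_top (x i) (x (i + e2))"
  shows "card (lang (cube n) X) \<le> 2 ^ card (cube n :: (int, 'd) vec set) *
    CARD(tile) ^ card (cube_face n (1::'d) \<union> cube_face n 2)"
proof -
  let ?C = "cube n :: (int, 'd) vec set" and ?S = "cube_face n (1::'d) \<union> cube_face n 2"
  let ?h = "\<lambda>p. ({i \<in> ?C. tile_bit (p i)}, restrict p ?S)"
  have SC: "?S \<subseteq> ?C" by (auto simp: cube_face_def)
  have finS: "finite ?S" using finite_cube SC finite_subset by blast
  have "inj_on ?h (lang ?C X)"
  proof (rule inj_onI)
    fix p q assume "p \<in> lang ?C X" "q \<in> lang ?C X" and eq: "?h p = ?h q"
    then obtain x y where x: "x \<in> X" "p = restrict x ?C" and y: "y \<in> X" "q = restrict y ?C"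
      unfolding lang_def by blast
    have eq1: "{i \<in> ?C. tile_bit (p i)} = {i \<in> ?C. tile_bit (q i)}"
      and eq2: "restrict p ?S = restrict q ?S"
      using eq by (simp_all only: prod.inject)
    have bit: "tile_bit (x i) \<longleftrightarrow> tile_bit (y i)" if "i \<in> ?C" for i
    proof -
      have "i \<in> {i \<in> ?C. tile_bit (p i)} \<longleftrightarrow> i \<in> {i \<in> ?C. tile_bit (q i)}"
        by (simp only: eq1)
      then show ?thesis using that by (simp add: x(2) y(2))
    qed
    have S: "x i = y i" if "i \<in> ?S" for i
    proof -
      have "restrict p ?S i = restrict q ?S i" by (simp only: eq2)
      moreover have "i \<in> ?C" using that SC by blast
      ultimately show ?thesis using that by (simp add: x(2) y(2) del: Un_iff)
    qed
    have "x i = y i" if "i \<in> ?C" for i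
      using that
    \<comment> \<open>This measure is nonnegative on the cube and drops in passing to the left or
      lower neighbour.\<close>
    proof (induction "nat (i $ 1 + i $ 2 + 2 * int n)" arbitrary: i rule: less_induct)
      case less
      show ?case
      proof (cases "i \<in> ?S")
        case False
        have rng: "- int n \<le> i $ k" "i $ k \<le> int n" for k
          using less.prems by (simp_all add: cube_eq_box)
        have "i $ 1 \<noteq> - int n" "i $ 2 \<noteq> - int n"
          using False less.prems by (auto simp: cube_face_def)
        with rng[of 1] rng[of 2] have gt: "i $ 1 > - int n" "i $ 2 > - int n" by auto
        \<comment> \<open>The class \<open>numeral\<close> does not guarantee that the indices 1 and
          2 differ, so these weaker facts are what holds for every index type.\<close>
        have e: "(e1 :: (int, 'd) vec) $ 1 = 1" "(e1 :: (int, 'd) vec) $ k \<in> {0, 1}" "(e1 :: (int, 'd) vec) $ k = 1 \<Longrightarrow> k = 1"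
          "(e2 :: (int, 'd) vec) $ 2 = 1" "(e2 :: (int, 'd) vec) $ k \<in> {0, 1}" "(e2 :: (int, 'd) vec) $ k = 1 \<Longrightarrow> k = 2" for k
          by (auto simp: e1_def e2_def axis_def split: if_splits)
        have C: "i - e1 \<in> ?C" "i - e2 \<in> ?C"
        proof -
          have "- int n \<le> (i - e1) $ k \<and> (i - e1) $ k \<le> int n" for k
            using rng[of k] e(2)[of k] e(3)[of k] gt by auto
          then show "i - e1 \<in> ?C" by (simp add: cube_eq_box)
          have "- int n \<le> (i - e2) $ k \<and> (i - e2) $ k \<le> int n" for k
            using rng[of k] e(5)[of k] e(6)[of k] gt by auto
          then show "i - e2 \<in> ?C" by (simp add: cube_eq_box)
        qed
        have "x (i - e1) = y (i - e1)"
          by (rule less.hyps[OF _ C(1)]) (use gt e(1) e(2)[of 2] in auto)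
        moreover have "x (i - e2) = y (i - e2)"
          by (rule less.hyps[OF _ C(2)]) (use gt e(4) e(5)[of 1] in auto)
        ultimately show ?thesis
          using bit[OF less.prems] X[OF x(1), of "i - e1"] X[OF y(1), of "i - e1"]
            X[OF x(1), of "i - e2"] X[OF y(1), of "i - e2"]
          by (intro tile_eqI) (simp_all add: match_right_def match_top_def)
      qed (simp add: S)
    qed
    then show "p = q" by (auto simp: x(2) y(2) restrict_def)
  qed
  moreover have "?h ` lang ?C X \<subseteq> Pow ?C \<times> (?S \<rightarrow>\<^sub>E UNIV)"
    by (intro image_subsetI) (simp add: restrict_PiE_iff)
  moreover have "finite (Pow ?C \<times> (?S \<rightarrow>\<^sub>E (UNIV :: tile set)))"
    using finS by (simp add: finite_cube finite_PiE)
  ultimately have "card (lang ?C X) \<le> card (Pow ?C \<times> (?S \<rightarrow>\<^sub>E (UNIV :: tile set)))"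
    by (rule card_inj_on_le)
  also have "\<dots> = 2 ^ card ?C * CARD(tile) ^ card ?S"
    using finS by (simp add: card_cartesian_product card_Pow finite_cube card_PiE)
  finally show ?thesis .
qed

text \<open>Both bounds are divided by the volume. The two faces contribute at most
  \<open>2 * ln CARD(tile) / (2 * n + 1)\<close>, which tends to 0. The index type is left open so
  that the result serves \<open>W_el\<close> and its projection alike.\<close>

lemma htop_eq_ln2:
  fixes X :: "((int, 'd::{finite,numeral}) vec \<Rightarrow> tile) set"
  assumes X: "\<And>x i. x \<in> X \<Longrightarrow> match_right (x i) (x (i + e1)) \<and> match_top (x i) (x (i + e2))"
    and blank: "\<And>x. (\<And>i. x i \<in> {T1_1, T1_2}) \<Longrightarrow> x \<in> X"
  shows "htop X = ln 2"
proof -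
  let ?c = "\<lambda>n. card (cube n :: (int, 'd) vec set)"
  let ?K = "real CARD(tile)"
  let ?r = "\<lambda>n. ln (real (card (lang (cube n) X))) / real (?c n)"
  have c: "?c n > 0" for n
    using zero_in_cube[of n] finite_cube by (auto simp: card_gt_0_iff)
  have K: "?K \<ge> 1" by (simp add: Suc_le_eq)
  have low: "ln 2 \<le> ?r n" for n
  proof -
    have le: "2 ^ ?c n \<le> real (card (lang (cube n) X))"
      using card_lang_lower[OF blank, where n = n, THEN of_nat_mono[where ?'a = real]]
      by (simp only: of_nat_power of_nat_numeral)
    have "real (?c n) * ln 2 = ln (2 ^ ?c n)" by (simp add: ln_realpow)
    also have "\<dots> \<le> ln (real (card (lang (cube n) X)))"
      using le by (intro ln_mono) auto
    finally show ?thesis using c[of n] by (simp add: field_simps)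
  qed
  have up: "?r n \<le> ln 2 + 2 * ln ?K / (2 * real n + 1)" for n
  proof -
    let ?s = "card (cube_face n (1::'d) \<union> cube_face n 2)"
    have "?s * (2 * n + 1) \<le> (card (cube_face n (1::'d)) + card (cube_face n (2::'d))) * (2 * n + 1)"
      by (intro mult_right_mono card_Un_le) simp
    then have "?s * (2 * n + 1) \<le> 2 * ?c n" by (simp only: add_mult_distrib card_cube_face)
    then have "real (?s * (2 * n + 1)) \<le> real (2 * ?c n)" by (simp only: of_nat_le_iff)
    then have s: "real ?s \<le> 2 * real (?c n) / (2 * real n + 1)"
      by (simp add: field_simps)
    have pos: "0 < real (card (lang (cube n) X))"
      using card_lang_lower[OF blank, where n = n]
      by (metis of_nat_0_less_iff less_le_trans zero_less_numeral zero_less_power)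
    have "real (card (lang (cube n) X)) \<le> 2 ^ ?c n * ?K ^ ?s"
      using card_lang_upper[OF X, where n = n, THEN of_nat_mono[where ?'a = real]]
      by (simp only: of_nat_mult of_nat_power of_nat_numeral)
    then have "ln (real (card (lang (cube n) X))) \<le> ln (2 ^ ?c n * ?K ^ ?s)"
      using pos by (intro ln_mono) auto
    also have "\<dots> = real (?c n) * ln 2 + real ?s * ln ?K"
      using K by (simp add: ln_mult ln_realpow)
    also have "\<dots> \<le> real (?c n) * ln 2 + 2 * real (?c n) / (2 * real n + 1) * ln ?K"
      using s K by (intro add_left_mono mult_right_mono) auto
    finally show ?thesis using c[of n] by (simp add: field_simps)
  qed
  have "(\<lambda>n. ln 2 + 2 * ln ?K / (2 * real n + 1)) \<longlonglongrightarrow> ln 2 + 0"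
    by (intro tendsto_add tendsto_const tendsto_divide_0 filterlim_compose[OF filterlim_real_at_infinity_sequentially])
       (auto intro!: filterlim_at_top_imp_at_infinity filterlim_tendsto_add_at_top filterlim_tendsto_pos_mult_at_top filterlim_real_sequentially simp: add.commute)
  then have lim: "(\<lambda>n. ln 2 + 2 * ln ?K / (2 * real n + 1)) \<longlonglongrightarrow> ln 2" by simp
  have "?r \<longlonglongrightarrow> ln 2"
    by (rule tendsto_sandwich[OF always_eventually always_eventually tendsto_const lim]) (use low up in blast)+
  then show ?thesis unfolding htop_def by (rule limI)
qed

lemma proj_L_W_el_W2: "y \<in> proj_L W_el \<Longrightarrow> y \<in> W2"
proof -
  assume "y \<in> proj_L W_el"
  then obtain x where x: "x \<in> W_el" "y = (\<lambda>u. x (L_emb u))" by (auto simp: proj_L_def)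
  have "layer 0 x \<in> W2" using x(1) by (simp add: W_el_def)
  then show "y \<in> W2" by (simp add: x(2) layer_def)
qed

lemma L_emb_coords: "L_emb u $ 1 = u $ 1" "L_emb u $ 2 = u $ 2" "L_emb u $ 3 = 0"
  by (simp_all add: L_emb_def)

text \<open>A blank plane is repeated in every layer, which is admissible since blanks may be
  stacked.\<close>

lemma blank_proj_L:
  assumes "\<And>i. y i \<in> {T1_1, T1_2}"
  shows "y \<in> proj_L W_el"
proof -
  let ?x = "\<lambda>i :: int ^ 3. y (vector [i $ 1, i $ 2])"
  have "?x \<in> W_el" using assms by (rule blank_W_el)
  moreover have "y = (\<lambda>u. ?x (L_emb u))"
  proof
    fix u
    have "vector [L_emb u $ 1, L_emb u $ 2] = u"
      by (simp add: L_emb_coords vec_eq_iff forall_2)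
    then show "y u = ?x (L_emb u)" by simp
  qed
  ultimately show ?thesis by (auto simp: proj_L_def)
qed

lemma htop_W_el: "htop W_el = ln 2"
  by (rule htop_eq_ln2) (simp add: W_el_iff_nbrs, rule blank_W_el)

lemma h_L_W_el: "h_L W_el = ln 2"
  unfolding h_L_def
  by (rule htop_eq_ln2) (use proj_L_W_el_W2 in \<open>simp add: W2_def\<close>, rule blank_proj_L)

section \<open>Independent layers\<close>

text \<open>Layer \<open>n\<close> of a point is layer 0 of its translate by
  \<open>n *s e3\<close>.\<close>

lemma W_el_subset_layerwise: "W_el \<subseteq> layerwise (proj_L W_el)"
proof
  fix x assume x: "x \<in> W_el"
  have "layer n x \<in> proj_L W_el" for n
  proof -
    have "layer n x = (\<lambda>u. shift (n *s e3) x (L_emb u))"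
      by (simp add: layer_def shift_def add.commute)
    then show ?thesis using shift_W_el[OF x] by (auto simp: proj_L_def)
  qed
  then show "x \<in> layerwise (proj_L W_el)" by (simp add: layerwise_def)
qed

lemma W_el_neq_layerwise: "W_el \<noteq> layerwise (proj_L W_el)"
proof -
  \<comment> \<open>One layer of tile 2 between blank layers is admissible, so the plane of tiles 2
    belongs to the projection; stacking it on itself breaks the vertical rule.\<close>
  let ?f = "\<lambda>a b c :: int. if c = 0 then T2 else T1_1"
  have "el_valid ?f" by (auto simp: el_valid_def match_right_def match_top_def)
  then have "(\<lambda>i. ?f (i $ 1) (i $ 2) (i $ 3)) \<in> W_el" by (rule W_el_coords)
  then have "(\<lambda>u. ?f (L_emb u $ 1) (L_emb u $ 2) (L_emb u $ 3)) \<in> proj_L W_el"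
    unfolding proj_L_def
    by (intro CollectI exI[of _ "\<lambda>i. ?f (i $ 1) (i $ 2) (i $ 3)"] conjI refl)
  then have "(\<lambda>u. T2) \<in> proj_L W_el" by (simp add: L_emb_coords)
  then have "(\<lambda>i. T2) \<in> layerwise (proj_L W_el)" by (simp add: layerwise_def layer_def)
  moreover have "(\<lambda>i. T2) \<notin> W_el" by (simp add: W_el_iff_nbrs vertical_ok_def)
  ultimately show ?thesis by blast
qed

theorem proposition2p2:
  "is_sft W_el \<and>
   extendible el_rules W_el \<and>
   block_strongly_irreducible W_el \<and>
   htop W_el = h_L W_el \<and>
   W_el \<subset> layerwise (proj_L W_el)"
  using is_sft_W_el extendible_W_el block_strongly_irreducible_W_el
    W_el_subset_layerwise W_el_neq_layerwise by (simp add: htop_W_el h_L_W_el psubset_eq)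

end
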